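(* Let $\gamma:[0,1]\to\mathbb{R}^d$ be a non-degenerate piecewise linear path consisting of $M>0$ linear pieces, and suppose $2\Omega>0$ is the smallest angle between two adjacent edges. Equip $\mathbb{R}^d$ and $\mathbb{R}^{d+1}$ with the Euclidean norm. Then for every $c\in(0,1)$ there exists a strictly increasing sequence $(n_k)_{k\ge1}$ of natural numbers such that $$\left\lVert\bar S_{n_k}\right\rVert_{\to\mathrm{Hom}(\mathbb{R}^{d+1},\mathbb{R}^{d+1})}\ \ge\ c\,\exp\bigl(-(M-1)K(\Omega)\bigr)\qquad\text{for all }k\ge1,$$ where $K(\Omega):=\log\left(\frac{2}{1-\cos|\Omega|}\right)$.
   Context: Normalised signature: for a path $\gamma$ of length $L>0$, $\bar S_n:=n!\,L^{-n}\int_{0<u_1<\cdots<u_n<1}d\gamma_{u_1}\otimes\cdots\otimes d\gamma_{u_n}\in(\mathbb{R}^d)^{\otimes n}$ (if $\gamma$ is parametrised at unit speed on $[0,1]$ then $L=1$). Non-degenerate piecewise linear path with $M$ pieces: a concatenation of $M$ line segments of positive length with successive vertices $x_0,x_1,\dots,x_M$ such that for each $0<i<M$ the angle $\angle x_{i-1}x_ix_{i+1}$ between the adjacent edges, i.e. the angle in $[0,\pi]$ between $x_{i-1}-x_i$ and $x_{i+1}-x_i$, lies in $(0,\pi)$. (So an angle close to $0$ means the path nearly reverses direction.) If $M=1$ there are no angles and $\exp(-(M-1)K(\Omega))$ is read as $1$. Norm $\lVert\cdot\rVert_{\to A}$: for a Banach space $V$, a Banach algebra $A$ and bounded linear maps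 $F_1,\dots,F_k\in\mathrm{Hom}(V,A)$, let $F_1\otimes\cdots\otimes F_k:V^{\otimes k}\to A$ be the linear extension of $v_1\otimes\cdots\otimes v_k\mapsto F_1(v_1)\cdots F_k(v_k)$. For $x\in V^{\otimes k}$, $$\lVert x\rVert_{\to A}:=\sup\bigl\{\lVert (F_1\otimes\cdots\otimes F_k)(x)\rVert_A:\ F_i\in\mathrm{Hom}(V,A),\ \lVert F_i\rVert_{\mathrm{Hom}(V,A)}=1\bigr\}.$$ Here $V=\mathbb{R}^d$ and $A=\mathrm{Hom}(\mathbb{R}^{d+1},\mathbb{R}^{d+1})$ with the operator norm. *)

theory Defs
  imports "HOL-Analysis.Analysis"
begin

text \<open>The angle at \<open>q\<close> between the vectors \<open>p - q\<close> and \<open>r - q\<close>, with values in \<open>[0, \<pi>]\<close>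
  (meaningful only if both vectors are nonzero).\<close>

definition vertex_angle :: "'a::real_inner \<Rightarrow> 'a \<Rightarrow> 'a \<Rightarrow> real" where
  "vertex_angle p q r = arccos (((p - q) \<bullet> (r - q)) / (norm (p - q) * norm (r - q)))"

text \<open>The parametrisation is only required to be affine on each piece: the breakpoints \<open>t\<close> are
  arbitrary.  Only the values of \<open>\<gamma>\<close> on \<open>[0, 1]\<close> are constrained, and only \<open>x 0, \<dots>, x M\<close> matter.\<close>

definition nondegenerate_piecewise_linear ::
    "(real \<Rightarrow> 'a::real_inner) \<Rightarrow> nat \<Rightarrow> (nat \<Rightarrow> 'a) \<Rightarrow> bool" where
  "nondegenerate_piecewise_linear \<gamma> M x \<longleftrightarrow>
     (\<exists>t :: nat \<Rightarrow> real. t 0 = 0 \<and> t M = 1 \<and>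
        (\<forall>i<M. t i < t (Suc i) \<and>
          (\<forall>u\<in>{t i..t (Suc i)}.
             \<gamma> u = linepath (x i) (x (Suc i)) ((u - t i) / (t (Suc i) - t i))))) \<and>
     (\<forall>i<M. x i \<noteq> x (Suc i)) \<and>
     (\<forall>i\<in>{0<..<M}. vertex_angle (x (i - 1)) (x i) (x (i + 1)) \<in> {0<..<pi})"

definition curve_length :: "(real \<Rightarrow> 'a::metric_space) \<Rightarrow> real" where
  "curve_length \<gamma> =
     Sup {(\<Sum>i<n. dist (\<gamma> (s i)) (\<gamma> (s (Suc i)))) | n s.
            mono_on {..n} s \<and> s ` {..n} \<subseteq> {0..1}}"

definition open_simplex :: "nat \<Rightarrow> (nat \<Rightarrow> real) set" where
  "open_simplex n = {u \<in> {..<n} \<rightarrow>\<^sub>E {0<..<1}. strict_mono_on {..<n} u}"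

text \<open>A tensor in \<open>(\<real>\<^sup>d)\<^bsup>\<otimes>n\<^esup>\<close> is given by its coordinates with respect to the standard basis
  \<open>e\<^bsub>w ! 0\<^esub> \<otimes> \<dots> \<otimes> e\<^bsub>w ! (n - 1)\<^esub>\<close>, indexed by the words \<open>w\<close> of length \<open>n\<close>; the values at words
  of other lengths are irrelevant.  In the signature, \<open>d\<gamma>\<^sub>u\<close> is read as \<open>\<gamma>'(u) du\<close>; for a
  piecewise linear path the derivative exists off the finitely many breakpoints.\<close>

definition normalised_signature :: "(real \<Rightarrow> real ^ 'd) \<Rightarrow> nat \<Rightarrow> 'd list \<Rightarrow> real" where
  "normalised_signature \<gamma> n w =
     fact n / curve_length \<gamma> ^ n *
     (LINT u : open_simplex n | Pi\<^sub>M {..<n} (\<lambda>_. lborel).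
        (\<Prod>k<n. vector_derivative \<gamma> (at (u k)) $ (w ! k)))"

text \<open>The Banach algebra \<open>Hom(W, W)\<close> is the type \<open>'w \<Rightarrow>\<^sub>L 'w\<close> of bounded linear maps with the operator
  norm, and its product is composition.\<close>

definition hom_product :: "nat \<Rightarrow> (nat \<Rightarrow> 'w::real_normed_vector \<Rightarrow>\<^sub>L 'w) \<Rightarrow> 'w \<Rightarrow>\<^sub>L 'w" where
  "hom_product n G = foldr (o\<^sub>L) (map G [0..<n]) id_blinfun"

definition tensor_hom ::
    "nat \<Rightarrow> (nat \<Rightarrow> (real ^ 'd) \<Rightarrow>\<^sub>L ('w::real_normed_vector \<Rightarrow>\<^sub>L 'w)) \<Rightarrow> ('d list \<Rightarrow> real) \<Rightarrow> 'w \<Rightarrow>\<^sub>L 'w"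
  where
  "tensor_hom n F T =
     (\<Sum>w | length w = n. T w *\<^sub>R hom_product n (\<lambda>k. blinfun_apply (F k) (axis (w ! k) 1)))"

text \<open>\<open>\<real>\<^bsup>d+1\<^esup>\<close> is \<^typ>\<open>real ^ 'd option\<close>, since \<open>CARD('d option) = CARD('d) + 1\<close>.\<close>

definition norm_to_hom :: "nat \<Rightarrow> ('d::finite list \<Rightarrow> real) \<Rightarrow> real" where
  "norm_to_hom n T =
     (SUP F \<in> {F :: nat \<Rightarrow> (real ^ 'd) \<Rightarrow>\<^sub>L ((real ^ 'd option) \<Rightarrow>\<^sub>L (real ^ 'd option)).
                  \<forall>k<n. norm (F k) = 1}.
        norm (tensor_hom n F T))"

definition K_const :: "real \<Rightarrow> real" where
  "K_const \<Omega> = ln (2 / (1 - cos \<bar>\<Omega>\<bar>))"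

text \<open>Consistency of the encoding: \<^const>\<open>tensor_hom\<close> takes the prescribed values on pure tensors,
  and the supremum in \<^const>\<open>norm_to_hom\<close> is over a nonempty bounded set.\<close>

lemma hom_product_0 [simp]: "hom_product 0 G = id_blinfun"
  by (simp add: hom_product_def)

lemma hom_product_Suc:
  "hom_product (Suc n) G = G 0 o\<^sub>L hom_product n (\<lambda>k. G (Suc k))"
proof -
  have "map G [0..<Suc n] = G 0 # map (\<lambda>k. G (Suc k)) [0..<n]"
    by (simp add: upt_conv_Cons map_Suc_upt [symmetric] o_def del: upt_Suc)
  then show ?thesis by (simp add: hom_product_def del: upt_Suc)
qed

lemma sum_words_Suc:
  fixes f :: "'d::finite list \<Rightarrow> 'b::comm_monoid_add"
  shows "(\<Sum>w | length w = Suc n. f w) = (\<Sum>i\<in>UNIV. \<Sum>w | length w = n. f (i # w))"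
proof -
  have "(\<Sum>i\<in>UNIV. \<Sum>w | length w = n. f (i # w))
      = (\<Sum>(i, w)\<in>UNIV \<times> {w. length w = n}. f (i # w))"
    by (simp add: sum.cartesian_product)
  also have "\<dots> = (\<Sum>w | length w = Suc n. f w)"
    by (rule sum.reindex_bij_witness [where i = "\<lambda>w. (hd w, tl w)" and j = "\<lambda>(i, w). i # w"])
      (auto simp: length_Suc_conv)
  finally show ?thesis by simp
qed

lemma tensor_hom_pure:
  fixes v :: "nat \<Rightarrow> real ^ 'd"
    and F :: "nat \<Rightarrow> (real ^ 'd) \<Rightarrow>\<^sub>L ('w::real_normed_vector \<Rightarrow>\<^sub>L 'w)"
  shows "tensor_hom n F (\<lambda>w. \<Prod>k<n. v k $ (w ! k)) = hom_product n (\<lambda>k. blinfun_apply (F k) (v k))"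
proof (induction n arbitrary: v F)
  case 0
  then show ?case by (simp add: tensor_hom_def)
next
  case (Suc n)
  interpret C: bounded_bilinear "(o\<^sub>L) :: ('w \<Rightarrow>\<^sub>L 'w) \<Rightarrow> ('w \<Rightarrow>\<^sub>L 'w) \<Rightarrow> 'w \<Rightarrow>\<^sub>L 'w"
    by (rule bounded_bilinear_blinfun_compose)
  let ?F = "\<lambda>k. F (Suc k)" and ?v = "\<lambda>k. v (Suc k)"
  have v0: "blinfun_apply (F 0) (v 0) = (\<Sum>i\<in>UNIV. (v 0 $ i) *\<^sub>R blinfun_apply (F 0) (axis i 1))"
  proof -
    have "v 0 = (\<Sum>i\<in>UNIV. (v 0 $ i) *\<^sub>R axis i 1)"
      using basis_expansion [of "v 0"] by (simp add: scalar_mult_eq_scaleR)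
    then have "blinfun_apply (F 0) (v 0)
        = blinfun_apply (F 0) (\<Sum>i\<in>UNIV. (v 0 $ i) *\<^sub>R axis i 1)"
      by (rule arg_cong)
    then show ?thesis
      by (simp only: blinfun.sum_right blinfun.scaleR_right)
  qed
  have "tensor_hom (Suc n) F (\<lambda>w. \<Prod>k<Suc n. v k $ (w ! k))
      = (\<Sum>i\<in>UNIV. \<Sum>w | length w = n.
          ((v 0 $ i) *\<^sub>R blinfun_apply (F 0) (axis i 1)) o\<^sub>L
          ((\<Prod>k<n. ?v k $ (w ! k)) *\<^sub>R hom_product n (\<lambda>k. blinfun_apply (?F k) (axis (w ! k) 1))))"
    unfolding tensor_hom_def sum_words_Suc
    by (intro sum.cong refl)
      (simp add: hom_product_Suc prod.lessThan_Suc_shift C.scaleR_left C.scaleR_right del: prod.lessThan_Suc)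
  also have "\<dots> = blinfun_apply (F 0) (v 0) o\<^sub>L tensor_hom n ?F (\<lambda>w. \<Prod>k<n. ?v k $ (w ! k))"
    unfolding v0 tensor_hom_def C.sum_left C.sum_right by (rule sum.swap)
  finally show ?case by (simp add: Suc.IH hom_product_Suc)
qed

lemma norm_hom_product_le:
  fixes G :: "nat \<Rightarrow> 'w::real_normed_vector \<Rightarrow>\<^sub>L 'w"
  assumes "\<And>k. k < n \<Longrightarrow> norm (G k) \<le> 1"
  shows "norm (hom_product n G) \<le> 1"
  using assms
proof (induction n arbitrary: G)
  case 0
  show ?case
    by (rule norm_blinfun_bound) auto
next
  case (Suc n)
  have "norm (hom_product (Suc n) G) \<le> norm (G 0) * norm (hom_product n (\<lambda>k. G (Suc k)))"
    unfolding hom_product_Suc by (rule norm_blinfun_compose)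
  also have "\<dots> \<le> 1 * 1"
    using Suc by (intro mult_mono) auto
  finally show ?case by simp
qed

lemma norm_to_hom_bdd:
  fixes T :: "'d::finite list \<Rightarrow> real"
  shows "bdd_above ((\<lambda>F. norm (tensor_hom n F T)) `
    {F :: nat \<Rightarrow> (real ^ 'd) \<Rightarrow>\<^sub>L ((real ^ 'd option) \<Rightarrow>\<^sub>L (real ^ 'd option)). \<forall>k<n. norm (F k) = 1})"
proof (rule bdd_aboveI2)
  fix F :: "nat \<Rightarrow> (real ^ 'd) \<Rightarrow>\<^sub>L ((real ^ 'd option) \<Rightarrow>\<^sub>L (real ^ 'd option))"
  assume "F \<in> {F. \<forall>k<n. norm (F k) = 1}"
  then have F: "norm (F k) = 1" if "k < n" for k using that by blast
  have "norm (blinfun_apply (F k) (axis (w ! k) 1)) \<le> 1" if "k < n" for k and w :: "'d list"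
    using norm_blinfun [of "F k" "axis (w ! k) 1"] F [OF that] by simp
  then have "norm (hom_product n (\<lambda>k. blinfun_apply (F k) (axis (w ! k) 1))) \<le> 1" for w :: "'d list"
    by (intro norm_hom_product_le)
  then show "norm (tensor_hom n F T) \<le> (\<Sum>w | length w = n. \<bar>T w\<bar>)"
    unfolding tensor_hom_def
    by (intro sum_norm_le) (simp add: mult_left_le)
qed

lemma norm_to_hom_nonempty:
  "{F :: nat \<Rightarrow> (real ^ 'd) \<Rightarrow>\<^sub>L ((real ^ 'd option) \<Rightarrow>\<^sub>L (real ^ 'd option)). \<forall>k<n. norm (F k) = 1} \<noteq> {}"
proof -
  define f :: "(real ^ 'd) \<Rightarrow>\<^sub>L ((real ^ 'd option) \<Rightarrow>\<^sub>L (real ^ 'd option))"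
    where "f = Blinfun (\<lambda>v. (v $ (SOME i. True)) *\<^sub>R id_blinfun)"
  have bl: "bounded_linear (\<lambda>v :: real ^ 'd. (v $ (SOME i. True)) *\<^sub>R
      (id_blinfun :: (real ^ 'd option) \<Rightarrow>\<^sub>L (real ^ 'd option)))"
    by (intro bounded_linear_scaleR_const bounded_linear_vec_nth)
  have "blinfun_apply f (axis (SOME i. True) 1) = id_blinfun"
    by (simp add: f_def bounded_linear_Blinfun_apply [OF bl])
  moreover have "id_blinfun \<noteq> (0 :: (real ^ 'd option) \<Rightarrow>\<^sub>L (real ^ 'd option))"
  proof
    assume "id_blinfun = (0 :: (real ^ 'd option) \<Rightarrow>\<^sub>L (real ^ 'd option))"
    then have "blinfun_apply id_blinfun (axis None 1 :: real ^ 'd option) = 0" by simp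
    then show False by simp
  qed
  ultimately have "f \<noteq> 0" by auto
  then have "norm (f /\<^sub>R norm f) = 1" by simp
  then have "(\<lambda>_::nat. f /\<^sub>R norm f) \<in> {F. \<forall>k<n. norm (F k) = 1}" by (simp only: mem_Collect_eq simp_thms)
  then show ?thesis by (metis empty_iff)
qed

end

theory Submission
  imports Defs
begin

text \<open>The supremum defining the norm of the signature is bounded below by a single representation, the
hyperbolic one: \<open>F v\<close> is the symmetric matrix with blocks \<open>0, v\<^sup>T\<close> and \<open>v, 0\<close>, the generator of the
Lorentz boosts in direction \<open>v\<close>.  It has operator norm \<open>|v|\<close>, so \<open>F\<close> has norm one.  Multiplying the
level \<open>n\<close> of the unnormalised signature by \<open>l\<^sup>n\<close>, applying \<open>F\<close> and summing over \<open>n\<close> gives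
the development of the path scaled by \<open>l\<close>, and for a piecewise linear path with edges of lengths
\<open>\<ell>\<^sub>i\<close> and directions \<open>v\<^sub>i\<close> this is the product of the exponentials \<open>exp (l \<ell>\<^sub>i F v\<^sub>i)\<close>.

For a unit vector \<open>v\<close> the eigenvalues of \<open>F v\<close> are among \<open>1, -1, 0\<close>, and the eigenspace of \<open>1\<close> is
spanned by the lightlike vector \<open>(1, v)\<close>.  Hence \<open>exp (- s) exp (s F v)\<close> tends to the orthogonal
projection onto \<open>(1, v)\<close> as \<open>s \<rightarrow> \<infinity>\<close>, and the development divided by \<open>exp (l L)\<close>,
where \<open>L\<close> is the sum of the \<open>\<ell>\<^sub>i\<close>, tends to a product of projections of rank one
(\<open>endpoint_series\<close>).  The norm of this product is the product of the cosines between successive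
lightlike lines, \<open>(1 + v\<^sub>i\<^sub>-\<^sub>1 \<bullet> v\<^sub>i) / 2 = (1 - cos \<theta>\<^sub>i) / 2\<close>, where \<open>\<theta>\<^sub>i\<close> is the angle between the edges.
As \<open>\<Omega> \<le> 2 \<Omega> \<le> \<theta>\<^sub>i \<le> \<pi>\<close>, each of these \<open>M - 1\<close> factors is at least \<open>(1 - cos \<Omega>) / 2\<close>, which is
\<open>exp (- K \<Omega>)\<close>.

On the other hand, the norms of the normalised signature are at least the coefficients of this
development, applied to a unit vector and weighted by \<open>n! / L\<^sup>n\<close>, since the length of the path is at
most \<open>L\<close> (\<open>norm_endpoint_coeff_le\<close>).  If all but finitely many of them were
below \<open>c exp (- (M - 1) K \<Omega>)\<close>, comparison with the exponential series would bound the limit by the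
same number (\<open>norm_limit_le_of_coefficient_bound\<close>), contradicting \<open>c < 1\<close>.  So infinitely many levels
satisfy the inequality.\<close>

section \<open>Infinitesimal Lorentz boosts\<close>

definition lightlike :: "real ^ 'd::finite \<Rightarrow> real ^ 'd option" where
  "lightlike v = (\<chi> j. case j of None \<Rightarrow> 1 | Some i \<Rightarrow> v $ i)"

definition boost :: "real ^ 'd::finite \<Rightarrow> real ^ 'd option \<Rightarrow> real ^ 'd option" where
  "boost v y = (\<chi> j. case j of None \<Rightarrow> \<Sum>i\<in>UNIV. v $ i * y $ Some i | Some i \<Rightarrow> v $ i * y $ None)"

text \<open>For a unit vector \<open>v\<close>, where \<open>lightlike v\<close> has squared norm \<open>2\<close>, this is the orthogonal projection
onto its line.\<close>

definition light_proj :: "real ^ 'd::finite \<Rightarrow> real ^ 'd option \<Rightarrow> real ^ 'd option" where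
  "light_proj v y = ((lightlike v \<bullet> y) / 2) *\<^sub>R lightlike v"

text \<open>The coordinate \<open>None\<close> is the time coordinate, the coordinates \<open>Some i\<close> are those of space.\<close>

lemma inner_option_vec:
  fixes y z :: "real ^ 'd::finite option"
  shows "y \<bullet> z = y $ None * z $ None + (\<Sum>i\<in>UNIV. y $ Some i * z $ Some i)"
  by (simp add: inner_vec_def UNIV_option_conv sum.reindex)

lemma option_vec_eqI:
  fixes y z :: "real ^ 'd::finite option"
  assumes "y $ None = z $ None" "\<And>i. y $ Some i = z $ Some i"
  shows "y = z"
  unfolding vec_eq_iff by (metis assms option.exhaust)

lemma boost_nth [simp]:
  "boost v y $ None = (\<Sum>i\<in>UNIV. v $ i * y $ Some i)"
  "boost v y $ Some i = v $ i * y $ None"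
  by (simp_all add: boost_def)

lemma lightlike_nth [simp]: "lightlike v $ None = 1" "lightlike v $ Some i = v $ i"
  by (simp_all add: lightlike_def)

lemma inner_lightlike: "lightlike v \<bullet> lightlike w = 1 + v \<bullet> w"
  unfolding inner_option_vec by (simp add: inner_vec_def)

lemma boost_selfadjoint: "boost v y \<bullet> z = y \<bullet> boost v z"
  unfolding inner_option_vec
  by (simp add: sum_distrib_left sum_distrib_right algebra_simps)

lemma norm_boost_le:
  fixes v :: "real ^ 'd::finite"
  shows "norm (boost v y) \<le> norm v * norm y"
proof (rule power2_le_imp_le)
  define y' :: "real ^ 'd" where "y' = (\<chi> i. y $ Some i)"
  have y: "y \<bullet> y = (y $ None)\<^sup>2 + y' \<bullet> y'"
    unfolding inner_option_vec by (simp add: y'_def inner_vec_def power2_eq_square)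
  have "boost v y \<bullet> boost v y = (v \<bullet> y')\<^sup>2 + (v \<bullet> v) * (y $ None)\<^sup>2"
    unfolding inner_option_vec
    by (simp add: y'_def inner_vec_def power2_eq_square sum_distrib_left sum_distrib_right ac_simps)
  also have "\<dots> \<le> (v \<bullet> v) * (y' \<bullet> y') + (v \<bullet> v) * (y $ None)\<^sup>2"
    using Cauchy_Schwarz_ineq [of v y'] by simp
  also have "\<dots> = (v \<bullet> v) * (y \<bullet> y)"
    unfolding y by (simp add: algebra_simps)
  finally show "(norm (boost v y))\<^sup>2 \<le> (norm v * norm y)\<^sup>2"
    by (simp add: power2_norm_eq_inner power_mult_distrib)
qed auto

interpretation boost: bounded_bilinear boost
proof
  show "\<exists>K. \<forall>v y. norm (boost v y) \<le> norm v * norm y * K"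
    by (intro exI [of _ 1]) (simp add: norm_boost_le)
qed (intro option_vec_eqI; simp add: algebra_simps sum.distrib sum_distrib_left)+

lemma boost_lightlike: "norm v = 1 \<Longrightarrow> boost v (lightlike v) = lightlike v"
  by (rule option_vec_eqI) (auto simp: norm_eq_1 inner_vec_def)

lemma boost_lightlike_minus: "norm v = 1 \<Longrightarrow> boost v (lightlike (- v)) = - lightlike (- v)"
  using boost_lightlike [of "- v"] by (metis add.inverse_inverse boost.minus_left norm_minus_cancel)

lemma boost_eq_light_proj: "boost v y = light_proj v y - light_proj (- v) y"
  by (rule option_vec_eqI)
    (simp_all add: light_proj_def inner_option_vec sum_negf field_simps)

text \<open>The spectral decomposition of a boost generator: \<open>light_proj v\<close> and \<open>light_proj (- v)\<close> are the
eigenprojections for \<open>1\<close> and \<open>-1\<close>, and the rest is the kernel.\<close>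

lemma boost_funpow:
  assumes "norm v = 1"
  shows "(boost v ^^ k) y = light_proj v y + (- 1) ^ k *\<^sub>R light_proj (- v) y
           + 0 ^ k *\<^sub>R (y - light_proj v y - light_proj (- v) y)"
proof (induction k)
  case 0
  then show ?case by simp
next
  case (Suc k)
  have p: "boost v (light_proj v x) = light_proj v x"
    and m: "boost v (light_proj (- v) x) = - light_proj (- v) x" for x
    using assms by (simp_all add: light_proj_def boost.scaleR_right boost_lightlike boost_lightlike_minus)
  have "boost v (y - light_proj v y - light_proj (- v) y) = 0"
    unfolding boost.diff_right p m by (simp add: boost_eq_light_proj)
  then show ?case
    by (simp add: Suc boost.add_right boost.scaleR_right p m)
qed

lemma light_proj_lightlike:
  "light_proj v (lightlike w) = ((1 + v \<bullet> w) / 2) *\<^sub>R lightlike v"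
  by (simp add: light_proj_def inner_lightlike)

lemma bounded_linear_light_proj: "bounded_linear (light_proj v)"
  unfolding light_proj_def divide_inverse
  by (intro bounded_linear_scaleR_const bounded_linear_mult_const bounded_linear_inner_right)

definition boost_hom :: "(real ^ 'd::finite) \<Rightarrow>\<^sub>L ((real ^ 'd option) \<Rightarrow>\<^sub>L (real ^ 'd option))" where
  "boost_hom = Blinfun boost.prod_right"

lemma boost_hom_apply [simp]: "blinfun_apply (blinfun_apply boost_hom v) y = boost v y"
  by (simp add: boost_hom_def bounded_linear_Blinfun_apply [OF boost.bounded_linear_prod_right])

lemma norm_boost_hom: "norm (boost_hom :: (real ^ 'd::finite) \<Rightarrow>\<^sub>L _) = 1"
proof (rule antisym)
  show "norm (boost_hom :: (real ^ 'd::finite) \<Rightarrow>\<^sub>L _) \<le> 1"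
    by (auto intro!: norm_blinfun_bound norm_boost_le)
  obtain v :: "real ^ 'd::finite" where v: "norm v = 1"
    using norm_axis_1 by blast
  have "1 * norm (lightlike v) \<le> norm (blinfun_apply boost_hom v) * norm (lightlike v)"
    using norm_blinfun [of "blinfun_apply boost_hom v" "lightlike v"] by (simp add: boost_lightlike v)
  moreover have "0 < norm (lightlike v)"
    by (metis lightlike_nth(1) zero_index zero_less_norm_iff zero_neq_one)
  ultimately have "1 \<le> norm (blinfun_apply boost_hom v)"
    by (meson mult_right_le_imp_le)
  also have "\<dots> \<le> norm (boost_hom :: (real ^ 'd::finite) \<Rightarrow>\<^sub>L _)"
    using norm_blinfun [of boost_hom v] v by simp
  finally show "1 \<le> norm (boost_hom :: (real ^ 'd::finite) \<Rightarrow>\<^sub>L _)" .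
qed

section \<open>The exponential of a boost as a power series\<close>

lemma Cauchy_product_scaleR_sums:
  fixes a :: "nat \<Rightarrow> real" and b :: "nat \<Rightarrow> 'a::euclidean_space"
  assumes a: "summable (\<lambda>k. norm (a k))" and b: "summable (\<lambda>k. norm (b k))"
  shows "(\<lambda>n. \<Sum>k\<le>n. a k *\<^sub>R b (n - k)) sums (suminf a *\<^sub>R suminf b)"
  unfolding sums_def
proof (subst tendsto_componentwise_iff, intro ballI)
  fix e :: 'a assume e: "e \<in> Basis"
  have "summable (\<lambda>k. norm (b k \<bullet> e))"
    using b by (rule summable_comparison_test') (use Basis_le_norm [OF e] in auto)
  then have "(\<lambda>n. \<Sum>k\<le>n. a k * (b (n - k) \<bullet> e)) sums (suminf a * (\<Sum>k. b k \<bullet> e))"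
    by (rule Cauchy_product_sums [OF a])
  moreover have "(\<Sum>k. b k \<bullet> e) = suminf b \<bullet> e"
    by (rule bounded_linear.suminf [OF bounded_linear_inner_left summable_norm_cancel [OF b], symmetric])
  ultimately show "(\<lambda>n. (\<Sum>i<n. \<Sum>k\<le>i. a k *\<^sub>R b (i - k)) \<bullet> e) \<longlonglongrightarrow> (suminf a *\<^sub>R suminf b) \<bullet> e"
    by (simp add: sums_def inner_sum_left)
qed

text \<open>Multiplication of a power series by \<open>exp (x F v)\<close>, where \<open>F v\<close> is the boost generator; the
coefficients \<open>d\<close> are those of the Cauchy product of the two series.\<close>

lemma boost_exp_sums:
  fixes b :: "nat \<Rightarrow> real ^ 'd::finite option" and x :: real
  assumes v: "norm v = 1" and b: "summable (\<lambda>n. norm (b n))"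
  defines "d \<equiv> \<lambda>n. \<Sum>k\<le>n. (x ^ k / fact k) *\<^sub>R (boost v ^^ k) (b (n - k))"
  shows "summable (\<lambda>n. norm (d n))"
    and "suminf d = exp x *\<^sub>R light_proj v (suminf b) + exp (- x) *\<^sub>R light_proj (- v) (suminf b)
           + (suminf b - light_proj v (suminf b) - light_proj (- v) (suminf b))"
proof -
  \<comment> \<open>by the spectral decomposition, \<open>d\<close> is the sum of three Cauchy products, one for each of the eigenvalues \<open>1\<close>, \<open>-1\<close>, \<open>0\<close>\<close>
  have ex: "summable (\<lambda>k. norm (y ^ k / fact k))" "(\<Sum>k. y ^ k / fact k) = exp y" for y :: real
    using summable_norm_exp [of y] by (simp_all add: exp_def field_simps)
  have sb: "summable b" by (rule summable_norm_cancel [OF b])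
  note bl = bounded_linear_light_proj
  have nrm: "norm ((boost v ^^ k) y) \<le> norm y" for k y
  proof (induction k)
    case (Suc k)
    then show ?case
      using norm_boost_le [of v "(boost v ^^ k) y"] v by simp
  qed simp
  show "summable (\<lambda>n. norm (d n))"
  proof (rule summable_comparison_test')
    show "summable (\<lambda>n. \<Sum>k\<le>n. norm (x ^ k / fact k) * norm (b (n - k)))"
      by (rule summable_Cauchy_product) (use ex b in auto)
    show "norm (norm (d n)) \<le> (\<Sum>k\<le>n. norm (x ^ k / fact k) * norm (b (n - k)))" for n
      unfolding d_def real_norm_def abs_norm_cancel
      by (rule sum_norm_le) (simp add: mult_left_mono nrm divide_right_mono)
  qed
  have pr: "summable (\<lambda>n. norm (light_proj w (b n)))" "(\<Sum>n. light_proj w (b n)) = light_proj w (suminf b)" for w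
  proof -
    obtain K where "\<And>x. norm (light_proj w x) \<le> norm x * K"
      using bounded_linear.bounded [OF bl] by blast
    then show "summable (\<lambda>n. norm (light_proj w (b n)))"
      by (intro summable_comparison_test' [OF summable_mult2 [OF b, of K]]) simp
    show "(\<Sum>n. light_proj w (b n)) = light_proj w (suminf b)"
      by (rule bounded_linear.suminf [OF bl sb, symmetric])
  qed
  have sp: "summable (\<lambda>n. light_proj w (b n))" for w
    by (rule summable_norm_cancel [OF pr(1)])
  have "(\<lambda>n. (\<Sum>k\<le>n. (x ^ k / fact k) *\<^sub>R light_proj v (b (n - k)))
          + (\<Sum>k\<le>n. ((- x) ^ k / fact k) *\<^sub>R light_proj (- v) (b (n - k)))
          + (b n - light_proj v (b n) - light_proj (- v) (b n)))
     sums (exp x *\<^sub>R light_proj v (suminf b) + exp (- x) *\<^sub>R light_proj (- v) (suminf b)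
           + (suminf b - light_proj v (suminf b) - light_proj (- v) (suminf b)))"
    using Cauchy_product_scaleR_sums [OF ex(1) pr(1)]
      summable_sums [OF sb] summable_sums [OF sp]
    by (intro sums_add sums_diff) (simp_all add: ex(2) pr(2))
  moreover have "(\<lambda>n. (\<Sum>k\<le>n. (x ^ k / fact k) *\<^sub>R light_proj v (b (n - k)))
          + (\<Sum>k\<le>n. ((- x) ^ k / fact k) *\<^sub>R light_proj (- v) (b (n - k)))
          + (b n - light_proj v (b n) - light_proj (- v) (b n))) = d"
  proof
    fix n
    have "d n = (\<Sum>k\<le>n. (x ^ k / fact k) *\<^sub>R light_proj v (b (n - k)))
          + (\<Sum>k\<le>n. ((- x) ^ k / fact k) *\<^sub>R light_proj (- v) (b (n - k)))
          + (\<Sum>k\<le>n. (x ^ k / fact k * 0 ^ k) *\<^sub>R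
              (b (n - k) - light_proj v (b (n - k)) - light_proj (- v) (b (n - k))))"
      unfolding d_def boost_funpow [OF v] sum.distrib [symmetric]
      by (intro sum.cong refl)
        (simp add: scaleR_add_right power_minus [of x] mult.commute)
    also have "(\<Sum>k\<le>n. (x ^ k / fact k * 0 ^ k) *\<^sub>R
              (b (n - k) - light_proj v (b (n - k)) - light_proj (- v) (b (n - k))))
       = (\<Sum>k\<le>n. if k = 0 then b n - light_proj v (b n) - light_proj (- v) (b n) else 0)"
      by (intro sum.cong) auto
    finally show "(\<Sum>k\<le>n. (x ^ k / fact k) *\<^sub>R light_proj v (b (n - k)))
          + (\<Sum>k\<le>n. ((- x) ^ k / fact k) *\<^sub>R light_proj (- v) (b (n - k)))
          + (b n - light_proj v (b n) - light_proj (- v) (b n)) = d n"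
      by (simp add: sum.delta)
  qed
  ultimately show "suminf d = exp x *\<^sub>R light_proj v (suminf b) + exp (- x) *\<^sub>R light_proj (- v) (suminf b)
           + (suminf b - light_proj v (suminf b) - light_proj (- v) (suminf b))"
    by (simp add: sums_iff)
qed

section \<open>Iterated integrals under the boost representation\<close>

definition time_simplex :: "real \<Rightarrow> nat \<Rightarrow> (nat \<Rightarrow> real) set" where
  "time_simplex s n = {u \<in> {..<n} \<rightarrow>\<^sub>E {0<..<s}. strict_mono_on {..<n} u}"

text \<open>The latest time acts last here, whereas \<^const>\<open>hom_product\<close> applies the latest factor first: the
two products are adjoint, as the factors are symmetric.\<close>

fun boost_path :: "(real \<Rightarrow> real ^ 'd::finite) \<Rightarrow> nat \<Rightarrow> (nat \<Rightarrow> real) \<Rightarrow> real ^ 'd option \<Rightarrow> real ^ 'd option"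
where
  "boost_path g 0 u z = z"
| "boost_path g (Suc n) u z = boost (g (u n)) (boost_path g n u z)"

definition development :: "(real \<Rightarrow> real ^ 'd::finite) \<Rightarrow> real ^ 'd option \<Rightarrow> nat \<Rightarrow> real \<Rightarrow> real ^ 'd option" where
  "development g z n s =
     (LINT u : time_simplex s n | Pi\<^sub>M {..<n} (\<lambda>_. lborel). boost_path g n u z)"

lemma hom_product_Suc_right: "hom_product (Suc n) G = hom_product n G o\<^sub>L G n"
proof (induction n arbitrary: G)
  case 0
  show ?case by (rule blinfun_eqI) (simp add: hom_product_def)
next
  case (Suc n)
  have "hom_product (Suc (Suc n)) G = G 0 o\<^sub>L (hom_product n (\<lambda>k. G (Suc k)) o\<^sub>L G (Suc n))"
    unfolding hom_product_Suc [of "Suc n" G] Suc.IH ..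
  also have "\<dots> = hom_product (Suc n) G o\<^sub>L G (Suc n)"
    by (rule blinfun_eqI) (simp add: hom_product_Suc)
  finally show ?case .
qed

lemma boost_path_adjoint:
  "blinfun_apply (hom_product n (\<lambda>k. blinfun_apply boost_hom (g (u k)))) y \<bullet> z
     = y \<bullet> boost_path g n u z"
proof (induction n arbitrary: y)
  case (Suc n)
  show ?case
    by (simp add: hom_product_Suc_right Suc boost_selfadjoint)
qed simp

lemma norm_boost_path_le:
  assumes "\<And>u. norm (g u) \<le> C"
  shows "norm (boost_path g n u z) \<le> C ^ n * norm z"
proof (induction n)
  case (Suc n)
  have "norm (boost_path g (Suc n) u z) \<le> norm (g (u n)) * norm (boost_path g n u z)"
    by (simp add: norm_boost_le)
  also have "\<dots> \<le> C * (C ^ n * norm z)"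
    by (intro mult_mono assms Suc order_trans [OF norm_ge_zero assms]) simp
  finally show ?case by (simp add: mult.assoc)
qed simp

lemma boost_path_cong: "(\<And>k. k < n \<Longrightarrow> u k = u' k) \<Longrightarrow> boost_path g n u z = boost_path g n u' z"
  by (induction n) auto

lemma borel_measurable_boost_path:
  assumes g: "g \<in> borel_measurable borel" and "n \<le> m"
  shows "(\<lambda>u. boost_path g n u z) \<in> borel_measurable (Pi\<^sub>M {..<m} (\<lambda>_. lborel))"
  using \<open>n \<le> m\<close>
proof (induction n)
  case (Suc n)
  have 1: "(\<lambda>u. g (u n)) \<in> borel_measurable (Pi\<^sub>M {..<m} (\<lambda>_. lborel))"
    by (rule measurable_compose [OF measurable_component_singleton]) (use g Suc in auto)
  have 2: "continuous_on UNIV (\<lambda>x :: (real ^ 'a) \<times> (real ^ 'a option). boost (fst x) (snd x))"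
    by (intro boost.continuous_on continuous_intros)
  show ?case
    using borel_measurable_continuous_Pair [OF 1 Suc.IH 2] Suc by simp
qed simp

lemma time_simplex_sets [measurable]: "time_simplex s n \<in> sets (Pi\<^sub>M {..<n} (\<lambda>_. lborel))"
proof -
  have "time_simplex s n = {u \<in> space (Pi\<^sub>M {..<n} (\<lambda>_. lborel)).
     (\<forall>i\<in>{..<n}. 0 < u i \<and> u i < s) \<and> (\<forall>i\<in>{..<n}. \<forall>j\<in>{..<n}. i < j \<longrightarrow> u i < u j)}"
    by (auto simp: time_simplex_def space_PiM PiE_iff strict_mono_on_def)
  also have "\<dots> \<in> sets (Pi\<^sub>M {..<n} (\<lambda>_. lborel))"
    by measurable
  finally show ?thesis .
qed

lemma emeasure_time_simplex_finite: "emeasure (Pi\<^sub>M {..<n} (\<lambda>_. lborel)) (time_simplex s n) < \<infinity>"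
proof -
  interpret product_sigma_finite "\<lambda>_::nat. lborel :: real measure" ..
  have "emeasure (Pi\<^sub>M {..<n} (\<lambda>_. lborel)) (time_simplex s n)
     \<le> emeasure (Pi\<^sub>M {..<n} (\<lambda>_. lborel)) ({..<n} \<rightarrow>\<^sub>E {0<..<s})"
    by (rule emeasure_mono) (auto simp: time_simplex_def intro!: sets_PiM_I_finite)
  also have "\<dots> = (\<Prod>i<n. emeasure lborel {0<..<s})"
    by (rule emeasure_PiM) auto
  also have "\<dots> < \<infinity>"
    by (cases "0 \<le> s") (auto simp: ennreal_power less_top [symmetric] power_0_left)
  finally show ?thesis .
qed

lemma set_integrable_time_simplex:
  fixes f :: "(nat \<Rightarrow> real) \<Rightarrow> 'b::{banach, second_countable_topology}"
  assumes f [measurable]: "f \<in> borel_measurable (Pi\<^sub>M {..<n} (\<lambda>_. lborel))"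
    and B: "\<And>u. norm (f u) \<le> B"
  shows "set_integrable (Pi\<^sub>M {..<n} (\<lambda>_. lborel)) (time_simplex s n) f"
  unfolding set_integrable_def
  by (rule integrableI_bounded_set [OF time_simplex_sets _ emeasure_time_simplex_finite, where B = B])
    (use order_trans [OF norm_ge_zero B] B in \<open>auto simp: indicator_def\<close>)

lemma time_simplex_Suc_iff:
  assumes "x \<in> extensional {..<n}"
  shows "x(n := y) \<in> time_simplex s (Suc n) \<longleftrightarrow> y \<in> {0<..<s} \<and> x \<in> time_simplex y n"
proof
  assume "x(n := y) \<in> time_simplex s (Suc n)"
  then have 1: "\<And>i. i < Suc n \<Longrightarrow> (x(n := y)) i \<in> {0<..<s}"
    and 2: "\<And>i j. i < j \<Longrightarrow> j < Suc n \<Longrightarrow> (x(n := y)) i < (x(n := y)) j"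
    by (auto simp: time_simplex_def PiE_iff strict_mono_on_def simp del: fun_upd_apply)
  have "0 < x i \<and> x i < y" if "i < n" for i
    using 1 [of i] 2 [of i n] that by auto
  moreover have "x i < x j" if "i < j" "j < n" for i j
    using 2 [of i j] that by auto
  ultimately show "y \<in> {0<..<s} \<and> x \<in> time_simplex y n"
    using 1 [of n] assms by (auto simp: time_simplex_def PiE_iff strict_mono_on_def)
next
  assume "y \<in> {0<..<s} \<and> x \<in> time_simplex y n"
  then show "x(n := y) \<in> time_simplex s (Suc n)"
    using assms
    by (auto simp: time_simplex_def PiE_iff strict_mono_on_def extensional_def less_Suc_eq
        intro: less_trans)
qed

lemma development_0: "development g z 0 s = z"
proof -
  have "time_simplex s 0 = {\<lambda>_. undefined}"
    by (auto simp: time_simplex_def)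
  then show ?thesis
    by (simp add: development_def set_lebesgue_integral_def PiM_empty lebesgue_integral_count_space_finite)
qed

text \<open>The differential equation \<open>D' = F g D\<close> of the development, read off level by level: Fubini's theorem
applied to the largest of the times.\<close>

lemma development_Suc:
  assumes g: "g \<in> borel_measurable borel" and C: "\<And>u. norm (g u) \<le> C"
  shows "(\<lambda>u. boost (g u) (development g z n u)) integrable_on {0..s}"
    and "development g z (Suc n) s = integral {0..s} (\<lambda>u. boost (g u) (development g z n u))"
proof -
  interpret product_sigma_finite "\<lambda>_::nat. lborel :: real measure" ..
  interpret F: finite_product_sigma_finite "\<lambda>_::nat. lborel :: real measure" "{..<n}"
    by standard auto
  let ?P = "Pi\<^sub>M {..<n} (\<lambda>_. lborel :: real measure)"
  interpret pair_sigma_finite ?P "lborel :: real measure" ..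
  define f where "f u = indicator (time_simplex s (Suc n)) u *\<^sub>R boost_path g (Suc n) u z" for u
  have ins: "{..<Suc n} = insert n {..<n}" by auto
  have int_f: "integrable (Pi\<^sub>M {..<Suc n} (\<lambda>_. lborel)) f"
    unfolding f_def
    using set_integrable_time_simplex [OF borel_measurable_boost_path [OF g order_refl] norm_boost_path_le [OF C]]
    by (simp only: set_integrable_def)
  have f_upd: "f (x(n := y)) = indicator {0<..<s} y *\<^sub>R
      boost (g y) (indicator (time_simplex y n) x *\<^sub>R boost_path g n x z)"
    if "x \<in> extensional {..<n}" for x y
  proof -
    have "boost_path g n (x(n := y)) z = boost_path g n x z"
      by (rule boost_path_cong) auto
    then show ?thesis
      using time_simplex_Suc_iff [OF that, of y s]
      by (auto simp: f_def indicator_def boost.zero_right)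
  qed
  have int_pair: "integrable (?P \<Otimes>\<^sub>M lborel) (\<lambda>(x, y). f (x(n := y)))"
  proof (rule integrableI_bounded_set)
    let ?A = "({..<n} \<rightarrow>\<^sub>E {0<..<s}) \<times> {0<..<s}"
    have A1: "({..<n} \<rightarrow>\<^sub>E {0<..<s}) \<in> sets ?P"
      by (rule sets_PiM_I_finite) auto
    then show "?A \<in> sets (?P \<Otimes>\<^sub>M lborel)"
      by (rule pair_measureI) auto
    have "f \<in> borel_measurable (Pi\<^sub>M (insert n {..<n}) (\<lambda>_. lborel))"
      using int_f unfolding ins by auto
    then show "(\<lambda>(x, y). f (x(n := y))) \<in> borel_measurable (?P \<Otimes>\<^sub>M lborel)"
      using measurable_comp [OF measurable_add_dim] by (simp add: comp_def case_prod_unfold)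
    have e: "emeasure lborel {0<..<s} < \<infinity>"
      by (cases "0 \<le> s") auto
    have "emeasure (?P \<Otimes>\<^sub>M lborel) ?A = (\<Prod>i<n. emeasure lborel {0<..<s}) * emeasure lborel {0<..<s}"
      using A1 by (simp add: lborel.emeasure_pair_measure_Times emeasure_PiM)
    also have "\<dots> < \<infinity>"
      using e by (auto simp: ennreal_mult_eq_top_iff ennreal_prod_eq_top less_top [symmetric] power_eq_top_ennreal)
    finally show "emeasure (?P \<Otimes>\<^sub>M lborel) ?A < \<infinity>" .
    show "AE x in ?P \<Otimes>\<^sub>M lborel. x \<in> ?A \<longrightarrow> norm (case x of (x, y) \<Rightarrow> f (x(n := y))) \<le> C ^ Suc n * norm z"
    proof (intro AE_I2 impI, clarify)
      fix x y
      have "norm (f (x(n := y))) \<le> norm (boost_path g (Suc n) (x(n := y)) z)"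
        by (simp add: f_def indicator_def)
      also have "\<dots> \<le> C ^ Suc n * norm z" by (rule norm_boost_path_le [OF C])
      finally show "norm (f (x(n := y))) \<le> C ^ Suc n * norm z" .
    qed
    show "AE x in ?P \<Otimes>\<^sub>M lborel. x \<notin> ?A \<longrightarrow> (case x of (x, y) \<Rightarrow> f (x(n := y))) = 0"
    proof (intro AE_I2 impI)
      fix xy assume "xy \<in> space (?P \<Otimes>\<^sub>M lborel)" "xy \<notin> ?A"
      moreover obtain x y where xy: "xy = (x, y)" by (cases xy)
      ultimately have "(x, y) \<in> space (?P \<Otimes>\<^sub>M lborel)" and A: "(x, y) \<notin> ?A" by simp_all
      then have x: "x \<in> extensional {..<n}"
        by (auto simp: space_pair_measure space_PiM PiE_iff)
      have "x \<in> {..<n} \<rightarrow>\<^sub>E {0<..<s}" if "y \<in> {0<..<s}" "x \<in> time_simplex y n"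
        using that by (auto simp: time_simplex_def PiE_iff) (meson lessThan_iff less_trans)
      then have "y \<notin> {0<..<s} \<or> x \<notin> time_simplex y n"
        using A by blast
      then show "(case xy of (x, y) \<Rightarrow> f (x(n := y))) = 0"
        unfolding xy prod.case f_upd [OF x] by (auto simp: boost.zero_right)
    qed
  qed
  have inner: "(LINT x|?P. f (x(n := y))) = indicator {0<..<s} y *\<^sub>R boost (g y) (development g z n y)" for y
  proof -
    have i: "integrable ?P (\<lambda>x. indicator (time_simplex y n) x *\<^sub>R boost_path g n x z)"
      using set_integrable_time_simplex [OF borel_measurable_boost_path [OF g order_refl] norm_boost_path_le [OF C]]
      by (simp only: set_integrable_def)
    have "(LINT x|?P. f (x(n := y))) = (LINT x|?P. indicator {0<..<s} y *\<^sub>R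
      boost (g y) (indicator (time_simplex y n) x *\<^sub>R boost_path g n x z))"
      by (rule Bochner_Integration.integral_cong) (auto simp: f_upd space_PiM PiE_iff)
    also have "\<dots> = indicator {0<..<s} y *\<^sub>R boost (g y)
        (LINT x|?P. indicator (time_simplex y n) x *\<^sub>R boost_path g n x z)"
      by (simp only: integral_scaleR_right integral_bounded_linear [OF boost.bounded_linear_right i])
    finally show ?thesis
      by (simp only: development_def set_lebesgue_integral_def)
  qed
  have si: "set_integrable lborel {0<..<s} (\<lambda>u. boost (g u) (development g z n u))"
    using integrable_snd [OF int_pair] unfolding inner set_integrable_def .
  have "development g z (Suc n) s = integral\<^sup>L (Pi\<^sub>M (insert n {..<n}) (\<lambda>_. lborel)) f"
    by (simp only: development_def set_lebesgue_integral_def f_def [abs_def] ins)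
  also have "\<dots> = (LINT x|?P. LINT y|lborel. f (x(n := y)))"
    using int_f unfolding ins by (intro product_integral_insert) auto
  also have "\<dots> = (LINT y|lborel. LINT x|?P. f (x(n := y)))"
    by (rule Fubini_integral [OF int_pair, symmetric])
  also have "\<dots> = (LINT u : {0<..<s} | lborel. boost (g u) (development g z n u))"
    by (simp only: inner set_lebesgue_integral_def)
  also have "\<dots> = integral {0<..<s} (\<lambda>u. boost (g u) (development g z n u))"
    by (rule set_borel_integral_eq_integral(2) [OF si])
  finally show "development g z (Suc n) s = integral {0..s} (\<lambda>u. boost (g u) (development g z n u))"
    by (simp only: integral_open_interval_real)
  show "(\<lambda>u. boost (g u) (development g z n u)) integrable_on {0..s}"
    using set_borel_integral_eq_integral(1) [OF si] by (simp only: integrable_on_open_interval_real)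
qed

text \<open>Chen's identity for the concatenation of a path with a segment of velocity \<open>w\<close>: the coefficients of
the development at \<open>r\<close> are those of the product of \<open>exp ((r - p) F w)\<close> with the development at \<open>p\<close>.\<close>

lemma development_linear_piece:
  assumes g: "g \<in> borel_measurable borel" and C: "\<And>u. norm (g u) \<le> C"
    and "0 \<le> p" and w: "\<And>u. u \<in> {p<..<q} \<Longrightarrow> g u = w" and r: "r \<in> {p..q}"
  shows "development g z n r =
    (\<Sum>k\<le>n. ((r - p) ^ k / fact k) *\<^sub>R (boost w ^^ k) (development g z (n - k) p))"
  using r
proof (induction n arbitrary: r)
  case 0
  then show ?case by (simp add: development_0)
next
  case (Suc n)
  let ?D = "\<lambda>n. development g z n p"
  let ?h = "\<lambda>u. boost (g u) (development g z n u)"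
  \<comment> \<open>the terms of the claim for \<open>Suc n\<close> with at least one factor \<open>boost w\<close>: an antiderivative of the integrand on the segment\<close>
  define H where "H u = (\<Sum>k\<le>n. ((u - p) ^ Suc k / fact (Suc k)) *\<^sub>R (boost w ^^ Suc k) (?D (n - k)))" for u
  have "((\<lambda>u. \<Sum>k\<le>n. ((u - p) ^ k / fact k) *\<^sub>R (boost w ^^ Suc k) (?D (n - k)))
      has_integral (H r - H p)) {p..r}"
  proof (rule fundamental_theorem_of_calculus)
    fix u assume "u \<in> {p..r}"
    have 1: "((\<lambda>u. (u - p) ^ Suc k / fact (Suc k)) has_real_derivative (u - p) ^ k / fact k) (at u within {p..r})" for k
      by (rule derivative_eq_intros refl | simp)+
    show "(H has_vector_derivative (\<Sum>k\<le>n. ((u - p) ^ k / fact k) *\<^sub>R (boost w ^^ Suc k) (?D (n - k))))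
      (at u within {p..r})"
      unfolding H_def
      by (intro has_vector_derivative_sum bounded_linear.has_vector_derivative [OF bounded_linear_scaleR_left]
          1 [unfolded has_real_derivative_iff_has_vector_derivative])
  qed (use Suc in auto)
  moreover have "(\<Sum>k\<le>n. ((u - p) ^ k / fact k) *\<^sub>R (boost w ^^ Suc k) (?D (n - k))) = ?h u"
    if "u \<in> {p<..<r}" for u
    using that Suc.prems
    by (simp add: w Suc.IH boost.sum_right boost.scaleR_right)
  ultimately have "(?h has_integral (H r - H p)) {p..r}"
    using has_integral_spike_interior [of _ "H r - H p" p r ?h] by (simp add: box_real)
  moreover have "H p = 0" by (simp add: H_def)
  ultimately have "integral {p..r} ?h = H r"
    by (simp add: integral_unique)
  moreover have "integral {0..p} ?h + integral {p..r} ?h = integral {0..r} ?h"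
    using Suc.prems \<open>0 \<le> p\<close> by (intro Henstock_Kurzweil_Integration.integral_combine development_Suc(1) [OF g C]) auto
  ultimately have "development g z (Suc n) r = ?D (Suc n) + H r"
    by (simp add: development_Suc(2) [OF g C])
  then show ?case
    by (simp add: H_def sum.atMost_Suc_shift del: sum.atMost_Suc)
qed

text \<open>Since \<open>boost_path\<close> is the adjoint of \<^const>\<open>hom_product\<close>, pairing the operator \<^const>\<open>tensor_hom\<close>
with \<open>z\<close> produces the development of \<open>z\<close>; testing on the development itself compares the norms.\<close>

lemma norm_development_le_tensor_hom:
  fixes \<gamma> g :: "real \<Rightarrow> real ^ 'd" and n :: nat
  assumes g: "g \<in> borel_measurable borel" and C: "\<And>u. norm (g u) \<le> C"
    and v: "\<And>u. u \<in> {0<..<1} \<Longrightarrow> vector_derivative \<gamma> (at u) = g u"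
  defines "T \<equiv> \<lambda>w. LINT u : open_simplex n | Pi\<^sub>M {..<n} (\<lambda>_. lborel).
        (\<Prod>k<n. vector_derivative \<gamma> (at (u k)) $ (w ! k))"
  shows "norm (development g z n 1) \<le> norm (tensor_hom n (\<lambda>_. boost_hom) T) * norm z"
proof -
  let ?P = "Pi\<^sub>M {..<n} (\<lambda>_. lborel :: real measure)"
  let ?hp = "\<lambda>w. hom_product n (\<lambda>k. blinfun_apply boost_hom (axis (w ! k) 1))"
  define D where "D = development g z n 1"
  have os: "open_simplex n = time_simplex 1 n"
    by (simp add: open_simplex_def time_simplex_def)
  have T: "T w = (LINT u : time_simplex 1 n | ?P. \<Prod>k<n. g (u k) $ (w ! k))" for w
    unfolding T_def os
    by (intro set_lebesgue_integral_cong time_simplex_sets allI impI prod.cong refl)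
      (auto simp: v time_simplex_def PiE_iff)
  have Ti: "set_integrable ?P (time_simplex 1 n) (\<lambda>u. \<Prod>k<n. g (u k) $ (w ! k))" for w
  proof (rule set_integrable_time_simplex)
    have "(\<lambda>u. g (u k) $ (w ! k)) \<in> borel_measurable ?P" if "k < n" for k
    proof -
      have "(\<lambda>x. g x $ (w ! k)) \<in> borel_measurable borel"
        using measurable_compose [OF g borel_measurable_continuous_onI [OF continuous_on_component [OF continuous_on_id]]] .
      then show ?thesis
        by (intro measurable_compose [OF measurable_component_singleton]) (use that in auto)
    qed
    then show "(\<lambda>u. \<Prod>k<n. g (u k) $ (w ! k)) \<in> borel_measurable ?P"
      by (intro borel_measurable_prod) auto
    show "norm (\<Prod>k<n. g (u k) $ (w ! k)) \<le> (\<Prod>k<n. C)" for u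
      unfolding prod_norm [symmetric]
      by (intro prod_mono) (auto intro: order_trans [OF component_le_norm_cart C])
  qed
  have Pi: "set_integrable ?P (time_simplex 1 n) (\<lambda>u. boost_path g n u z)"
    by (rule set_integrable_time_simplex [OF borel_measurable_boost_path [OF g order_refl] norm_boost_path_le [OF C]])
  have "D \<bullet> D = (LINT u : time_simplex 1 n | ?P. D \<bullet> boost_path g n u z)"
    using Pi unfolding D_def development_def set_lebesgue_integral_def set_integrable_def
    by (simp flip: integral_inner_right)
  also have "\<dots> = (LINT u : time_simplex 1 n | ?P.
      \<Sum>w | length w = n. (\<Prod>k<n. g (u k) $ (w ! k)) * (blinfun_apply (?hp w) D \<bullet> z))"
  proof (intro set_lebesgue_integral_cong time_simplex_sets allI impI)
    fix u
    have "D \<bullet> boost_path g n u z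
      = blinfun_apply (tensor_hom n (\<lambda>_. boost_hom) (\<lambda>w. \<Prod>k<n. g (u k) $ (w ! k))) D \<bullet> z"
      by (simp only: tensor_hom_pure boost_path_adjoint)
    then show "D \<bullet> boost_path g n u z
      = (\<Sum>w | length w = n. (\<Prod>k<n. g (u k) $ (w ! k)) * (blinfun_apply (?hp w) D \<bullet> z))"
      by (simp add: tensor_hom_def blinfun.sum_left blinfun.scaleR_left inner_sum_left)
  qed
  also have "\<dots> = (\<Sum>w | length w = n. T w * (blinfun_apply (?hp w) D \<bullet> z))"
    using Ti unfolding T set_lebesgue_integral_def set_integrable_def
    by (simp add: sum_distrib_left mult.assoc [symmetric])
  also have "\<dots> = blinfun_apply (tensor_hom n (\<lambda>_. boost_hom) T) D \<bullet> z"
    by (simp add: tensor_hom_def blinfun.sum_left blinfun.scaleR_left inner_sum_left)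
  also have "\<dots> \<le> norm (blinfun_apply (tensor_hom n (\<lambda>_. boost_hom) T) D) * norm z"
    by (rule norm_cauchy_schwarz)
  also have "\<dots> \<le> (norm (tensor_hom n (\<lambda>_. boost_hom) T) * norm D) * norm z"
    by (intro mult_right_mono norm_blinfun) simp
  finally have "norm D * norm D \<le> norm D * (norm (tensor_hom n (\<lambda>_. boost_hom) T) * norm z)"
    by (simp add: power2_norm_eq_inner [symmetric] power2_eq_square mult_ac)
  then show ?thesis
    unfolding D_def [symmetric] by (cases "D = 0") auto
qed

section \<open>From the growth of a power series to its coefficients\<close>

text \<open>Finitely many coefficients contribute a polynomial, which is negligible against \<open>exp (l len)\<close>; the
others are dominated by \<open>b\<close> times the exponential series.\<close>

lemma norm_limit_le_of_coefficient_bound: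
  fixes a :: "nat \<Rightarrow> 'a::banach"
  assumes lim: "((\<lambda>l. exp (- l * len) *\<^sub>R (\<Sum>n. l ^ n *\<^sub>R a n)) \<longlongrightarrow> y) at_top"
    and summ: "\<And>l. summable (\<lambda>n. norm (l ^ n *\<^sub>R a n))"
    and len: "len > 0" and b: "b \<ge> 0"
    and a: "\<And>n. n \<ge> N \<Longrightarrow> norm (a n) \<le> b * (len ^ n / fact n)"
  shows "norm y \<le> b"
proof (rule tendsto_le)
  show "((\<lambda>l. norm (exp (- l * len) *\<^sub>R (\<Sum>n. l ^ n *\<^sub>R a n))) \<longlongrightarrow> norm y) at_top"
    by (intro tendsto_norm lim)
  have "((\<lambda>l::real. l ^ n / exp (l * len)) \<longlongrightarrow> 0) at_top" for n
  proof -
    have "((\<lambda>l::real. (l * len) ^ n / exp (l * len)) \<longlongrightarrow> 0) at_top"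
      using filterlim_tendsto_pos_mult_at_top [OF tendsto_const len filterlim_ident]
      by (intro filterlim_compose [OF tendsto_power_div_exp_0]) (simp add: mult.commute)
    then have "((\<lambda>l::real. (l * len) ^ n / exp (l * len) * (1 / len ^ n)) \<longlongrightarrow> 0 * (1 / len ^ n)) at_top"
      by (intro tendsto_mult tendsto_const)
    then show ?thesis using len by (simp add: power_mult_distrib)
  qed
  then have "((\<lambda>l. b + (\<Sum>n<N. norm (a n) * (l ^ n / exp (l * len)))) \<longlongrightarrow> b + (\<Sum>n<N. norm (a n) * 0)) at_top"
    by (intro tendsto_intros)
  then show "((\<lambda>l. b + (\<Sum>n<N. norm (a n) * (l ^ n / exp (l * len)))) \<longlongrightarrow> b) at_top"
    by simp
  show "\<forall>\<^sub>F l in at_top. norm (exp (- l * len) *\<^sub>R (\<Sum>n. l ^ n *\<^sub>R a n))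
      \<le> b + (\<Sum>n<N. norm (a n) * (l ^ n / exp (l * len)))"
    using eventually_ge_at_top [of 0]
  proof eventually_elim
    case (elim l)
    have e: "(\<lambda>n. b * ((l * len) ^ n / fact n)) sums (b * exp (l * len))"
      using exp_converges [of "l * len"] by (intro sums_mult) (simp add: field_simps)
    have f: "(\<lambda>n. if n \<in> {..<N} then norm (a n) * l ^ n else 0) sums (\<Sum>n<N. norm (a n) * l ^ n)"
      by (rule sums_If_finite_set) simp
    have s: "(\<lambda>n. b * ((l * len) ^ n / fact n) + (if n \<in> {..<N} then norm (a n) * l ^ n else 0))
        sums (b * exp (l * len) + (\<Sum>n<N. norm (a n) * l ^ n))"
      by (rule sums_add [OF e f])
    have le: "norm (l ^ n *\<^sub>R a n) \<le> b * ((l * len) ^ n / fact n) + (if n \<in> {..<N} then norm (a n) * l ^ n else 0)" for n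
    proof (cases "n < N")
      case True
      then show ?thesis using elim b len by (simp add: mult.commute)
    next
      case False
      then have "l ^ n * norm (a n) \<le> l ^ n * (b * (len ^ n / fact n))"
        using elim a [of n] by (intro mult_left_mono) auto
      then show ?thesis using False elim by (simp add: power_mult_distrib mult_ac)
    qed
    have "norm (\<Sum>n. l ^ n *\<^sub>R a n) \<le> (\<Sum>n. norm (l ^ n *\<^sub>R a n))"
      by (rule summable_norm [OF summ])
    also have "\<dots> \<le> b * exp (l * len) + (\<Sum>n<N. norm (a n) * l ^ n)"
      unfolding sums_unique [OF s] by (rule suminf_le [OF le summ sums_summable [OF s]])
    finally have "exp (- l * len) * norm (\<Sum>n. l ^ n *\<^sub>R a n)
        \<le> exp (- l * len) * (b * exp (l * len) + (\<Sum>n<N. norm (a n) * l ^ n))"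
      by (rule mult_left_mono) simp
    also have "\<dots> = b + (\<Sum>n<N. norm (a n) * (l ^ n / exp (l * len)))"
      by (simp add: exp_minus field_simps sum_distrib_left sum_divide_distrib)
    finally show ?case by simp
  qed
qed simp

section \<open>Piecewise linear paths\<close>

lemma finite_piecewise_constant:
  fixes g :: "'a::topological_space \<Rightarrow> 'b::{real_normed_vector, second_countable_topology}"
  assumes C: "finite C" "\<Union>C = UNIV"
    and borel: "\<And>A. A \<in> C \<Longrightarrow> A \<in> sets borel" and const: "\<And>A. A \<in> C \<Longrightarrow> g constant_on A"
  shows "g \<in> borel_measurable borel" and "\<exists>B. \<forall>u. norm (g u) \<le> B"
proof -
  show "g \<in> borel_measurable borel"
  proof (rule measurable_piecewise_restrict [where C = C])
    fix A assume "A \<in> C"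
    then obtain c where c: "\<And>u. u \<in> A \<Longrightarrow> g u = c"
      using const unfolding constant_on_def by metis
    show "g \<in> borel_measurable (restrict_space borel A)"
      by (subst measurable_cong [where g = "\<lambda>_. c"]) (auto simp: c space_restrict_space)
  qed (use assms in \<open>auto simp: countable_finite\<close>)
  have "finite (range g)"
  proof -
    have "range g = (\<Union>A\<in>C. g ` A)" using C(2) by auto
    moreover have "finite (g ` A)" if "A \<in> C" for A
      using const [OF that] unfolding constant_on_def
      by (metis finite.simps finite_subset image_subsetI insertI1)
    ultimately show ?thesis using C(1) by simp
  qed
  then show "\<exists>B. \<forall>u. norm (g u) \<le> B"
    by (meson bounded_iff finite_imp_bounded rangeI)
qed

locale linear_pieces =
  fixes \<gamma> :: "real \<Rightarrow> real ^ 'd::finite" and M :: nat and x :: "nat \<Rightarrow> real ^ 'd" and t :: "nat \<Rightarrow> real"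
  assumes t_0: "t 0 = 0" and t_M: "t M = 1"
    and t_less: "\<And>i. i < M \<Longrightarrow> t i < t (Suc i)"
    and on_piece: "\<And>i u. i < M \<Longrightarrow> u \<in> {t i..t (Suc i)} \<Longrightarrow>
          \<gamma> u = linepath (x i) (x (Suc i)) ((u - t i) / (t (Suc i) - t i))"
    and edge: "\<And>i. i < M \<Longrightarrow> x i \<noteq> x (Suc i)"
begin

definition edge_length :: "nat \<Rightarrow> real" where "edge_length i = norm (x (Suc i) - x i)"

definition direction :: "nat \<Rightarrow> real ^ 'd" where "direction i = (x (Suc i) - x i) /\<^sub>R edge_length i"

text \<open>The path is unconstrained outside \<open>[0, 1]\<close>, so its derivative is cut off there; the result is
bounded and Borel measurable, being constant on each of finitely many Borel sets.\<close>

definition velocity :: "real \<Rightarrow> real ^ 'd" where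
  "velocity u = (if 0 < u \<and> u < 1 then vector_derivative \<gamma> (at u) else 0)"

lemma M_pos: "M > 0"
  using t_0 t_M by (cases M) auto

lemma edge_length_pos: "i < M \<Longrightarrow> edge_length i > 0"
  using edge [of i] by (simp add: edge_length_def)

lemma norm_direction: "i < M \<Longrightarrow> norm (direction i) = 1"
  using edge_length_pos [of i] by (simp add: direction_def edge_length_def)

lemma t_mono: "i \<le> j \<Longrightarrow> j \<le> M \<Longrightarrow> t i \<le> t j"
proof (induction j rule: dec_induct)
  case (step j)
  then show ?case using t_less [of j] by simp
qed simp

lemma pieces_cover: "m \<le> M \<Longrightarrow> {0..t m} \<subseteq> (\<Union>i<m. {t i<..<t (Suc i)}) \<union> t ` {..m}"
proof (induction m)
  case 0
  then show ?case by (auto simp: t_0)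
next
  case (Suc m)
  have "{0..t (Suc m)} \<subseteq> {0..t m} \<union> {t m<..<t (Suc m)} \<union> {t (Suc m)}"
    by auto
  then show ?case using Suc by (force simp: lessThan_Suc atMost_Suc)
qed

lemma velocity_piece:
  assumes i: "i < M" and u: "u \<in> {t i<..<t (Suc i)}"
  shows "velocity u = (edge_length i / (t (Suc i) - t i)) *\<^sub>R direction i"
proof -
  let ?h = "t (Suc i) - t i"
  have h: "?h > 0" using t_less [OF i] by simp
  have "((\<lambda>u. linepath (x i) (x (Suc i)) ((u - t i) / ?h)) has_vector_derivative (1 / ?h) *\<^sub>R (x (Suc i) - x i)) (at u)"
  proof -
    have "((\<lambda>u. (u - t i) / ?h) has_real_derivative 1 / ?h) (at u)"
      using h by (auto intro!: derivative_eq_intros)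
    then have "((\<lambda>u. x i + ((u - t i) / ?h) *\<^sub>R (x (Suc i) - x i)) has_vector_derivative
        0 + (1 / ?h) *\<^sub>R (x (Suc i) - x i)) (at u)"
      unfolding has_real_derivative_iff_has_vector_derivative
      by (intro has_vector_derivative_add has_vector_derivative_const
          bounded_linear.has_vector_derivative [OF bounded_linear_scaleR_left])
    moreover have "linepath (x i) (x (Suc i)) r = x i + r *\<^sub>R (x (Suc i) - x i)" for r
      by (simp add: linepath_def algebra_simps)
    ultimately show ?thesis by simp
  qed
  then have "(\<gamma> has_vector_derivative (1 / ?h) *\<^sub>R (x (Suc i) - x i)) (at u)"
    by (rule has_vector_derivative_transform_within_open [where S = "{t i<..<t (Suc i)}"])
      (use u on_piece [OF i] in auto)
  then have "vector_derivative \<gamma> (at u) = (1 / ?h) *\<^sub>R (x (Suc i) - x i)"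
    by (rule vector_derivative_at)
  moreover have "0 < u" "u < 1"
    using u t_mono [of 0 i] t_mono [of "Suc i" M] i by (auto simp: t_0 t_M)
  ultimately show ?thesis
    using edge_length_pos [OF i] by (simp add: velocity_def direction_def)
qed

lemma velocity_measurable: "velocity \<in> borel_measurable borel"
  and velocity_bounded: "\<exists>B. \<forall>u. norm (velocity u) \<le> B"
proof -
  let ?C = "(\<lambda>i. {t i<..<t (Suc i)}) ` {..<M} \<union> (\<lambda>i. {t i}) ` {..M} \<union> {{..<0}, {1<..}}"
  have 1: "finite ?C" by simp
  have "u \<in> \<Union>?C" for u
  proof (cases "u \<in> {0..t M}")
    case True
    then have "u \<in> (\<Union>i<M. {t i<..<t (Suc i)}) \<union> t ` {..M}"
      using pieces_cover [of M] by blast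
    then show ?thesis by auto
  next
    case False
    then have "u \<in> {..<0} \<union> {1<..}" by (auto simp: t_M)
    then show ?thesis by auto
  qed
  then have 2: "\<Union>?C = UNIV" by blast
  have 3: "A \<in> ?C \<Longrightarrow> A \<in> sets borel" for A by auto
  have 4: "velocity constant_on A" if A: "A \<in> ?C" for A
  proof -
    consider i where "i < M" "A = {t i<..<t (Suc i)}" | i where "A = {t i}" | "A \<subseteq> {..<0} \<union> {1<..}"
      using A by auto
    then show ?thesis
    proof cases
      case 1
      then show ?thesis using velocity_piece [of i] unfolding constant_on_def by blast
    next
      case 2
      then show ?thesis by (simp add: constant_on_def)
    next
      case 3
      then show ?thesis unfolding constant_on_def by (intro exI [of _ 0]) (auto simp: velocity_def)
    qed
  qed
  show "velocity \<in> borel_measurable borel" "\<exists>B. \<forall>u. norm (velocity u) \<le> B"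
    using finite_piecewise_constant [OF 1 2 3 4] by blast+
qed

text \<open>The fraction of the edge \<open>i\<close> that has been traversed at time \<open>u\<close>.\<close>

definition progress :: "nat \<Rightarrow> real \<Rightarrow> real" where
  "progress i u = max 0 (min 1 ((u - t i) / (t (Suc i) - t i)))"

lemma progress_mono: "i < M \<Longrightarrow> u \<le> u' \<Longrightarrow> progress i u \<le> progress i u'"
  using t_less [of i] unfolding progress_def
  by (intro max.mono min.mono order_refl divide_right_mono) auto

lemma path_eq_progress_sum:
  assumes "m \<le> M" "u \<in> {0..t m}"
  shows "\<gamma> u = x 0 + (\<Sum>i<m. progress i u *\<^sub>R (x (Suc i) - x i))"
  using assms
proof (induction m)
  case 0
  then show ?case
    using on_piece [OF M_pos, of 0] t_less [OF M_pos] by (auto simp: t_0 linepath_def)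
next
  case (Suc m)
  have h: "t (Suc m) - t m > 0" using t_less [of m] Suc.prems by simp
  show ?case
  proof (cases "u \<le> t m")
    case True
    then have "progress m u = 0"
      using h by (simp add: progress_def divide_nonpos_pos)
    then show ?thesis using True Suc by simp
  next
    case False
    have "progress i u = 1" if "i < m" for i
    proof -
      have "t (Suc i) \<le> u" "t i < t (Suc i)"
        using t_mono [of "Suc i" m] t_less [of i] False that Suc.prems by auto
      then show ?thesis by (simp add: progress_def)
    qed
    then have "(\<Sum>i<m. progress i u *\<^sub>R (x (Suc i) - x i)) = x m - x 0"
      by (simp add: sum_lessThan_telescope)
    moreover have "progress m u = (u - t m) / (t (Suc m) - t m)"
      using False Suc.prems h by (simp add: progress_def)
    ultimately show ?thesis
      using on_piece [of m u] False Suc.prems by (simp add: linepath_def algebra_simps)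
  qed
qed

text \<open>By \<open>path_eq_progress_sum\<close> the distance of two points of the path is at most the length of the edges
traversed between them, and the latter is additive, so it bounds every polygonal sum.\<close>

lemma curve_length_pos: "curve_length \<gamma> > 0"
  and curve_length_le: "curve_length \<gamma> \<le> (\<Sum>i<M. edge_length i)"
proof -
  define A where "A u = (\<Sum>i<M. progress i u * edge_length i)" for u
  let ?S = "{(\<Sum>i<n. dist (\<gamma> (s i)) (\<gamma> (s (Suc i)))) | n s.
            mono_on {..n} s \<and> s ` {..n} \<subseteq> {0..1::real}}"
  have dist_le: "dist (\<gamma> u) (\<gamma> u') \<le> A u' - A u" if "0 \<le> u" "u \<le> u'" "u' \<le> 1" for u u'
  proof -
    have "\<gamma> u' - \<gamma> u = (\<Sum>i<M. (progress i u' - progress i u) *\<^sub>R (x (Suc i) - x i))"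
      using path_eq_progress_sum [of M u] path_eq_progress_sum [of M u'] that
      by (simp add: t_M scaleR_diff_left sum_subtractf)
    also have "norm \<dots> \<le> (\<Sum>i<M. (progress i u' - progress i u) * edge_length i)"
      using progress_mono [of _ u u'] that
      by (intro sum_norm_le) (simp add: edge_length_def)
    finally show ?thesis
      by (simp add: A_def dist_norm norm_minus_commute left_diff_distrib sum_subtractf)
  qed
  have A01: "A 0 \<ge> 0" "A 1 \<le> (\<Sum>i<M. edge_length i)"
    unfolding A_def
    by (auto intro!: sum_nonneg sum_mono mult_nonneg_nonneg mult_left_le_one_le
        simp: progress_def edge_length_def)
  have A_mono: "A u \<le> A u'" if "u \<le> u'" for u u'
    unfolding A_def using progress_mono that
    by (intro sum_mono mult_right_mono) (auto simp: edge_length_def)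
  have le: "y \<le> (\<Sum>i<M. edge_length i)" if y_mem: "y \<in> ?S" for y
  proof -
    obtain n s where y: "y = (\<Sum>i<n. dist (\<gamma> (s i)) (\<gamma> (s (Suc i))))"
      and s: "mono_on {..n} s" "s ` {..n} \<subseteq> {0..1}"
      using y_mem by blast
    have s01: "0 \<le> s i" "s i \<le> 1" if "i \<le> n" for i
      using s(2) that by (auto simp: image_subset_iff)
    have "y \<le> (\<Sum>i<n. A (s (Suc i)) - A (s i))"
      unfolding y using s01 s(1) by (intro sum_mono dist_le) (auto simp: mono_on_def)
    also have "\<dots> = A (s n) - A (s 0)"
      by (rule sum_lessThan_telescope)
    also have "\<dots> \<le> A 1 - A 0"
      using s01 [of n] s01 [of 0] by (intro diff_mono A_mono) auto
    finally show ?thesis using A01 by simp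
  qed
  have "\<gamma> 0 = x 0" "\<gamma> (t 1) = x 1"
    using on_piece [OF M_pos, of 0] on_piece [OF M_pos, of "t 1"] t_less [OF M_pos]
    by (auto simp: t_0 linepath_def)
  then have "dist (\<gamma> 0) (\<gamma> (t 1)) > 0"
    using edge [OF M_pos] by simp
  moreover have mem: "dist (\<gamma> 0) (\<gamma> (t 1)) \<in> ?S"
  proof -
    have "0 \<le> t 1" "t 1 \<le> 1"
      using t_mono [of 0 1] t_mono [of 1 M] M_pos by (auto simp: t_0 t_M)
    then show ?thesis
      by (intro CollectI exI [of _ 1] exI [of _ "\<lambda>i. if i = 0 then 0 else t 1"])
        (auto simp: mono_on_def)
  qed
  moreover have "dist (\<gamma> 0) (\<gamma> (t 1)) \<le> curve_length \<gamma>"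
    unfolding curve_length_def by (rule cSup_upper [OF mem bdd_aboveI [OF le]])
  ultimately show "curve_length \<gamma> > 0" by linarith
  show "curve_length \<gamma> \<le> (\<Sum>i<M. edge_length i)"
    unfolding curve_length_def by (rule cSup_least) (use mem le in blast)+
qed

text \<open>The initial vector is the eigenvector of the boost along the first edge, so that this edge
contributes no loss.\<close>

abbreviation "endpoint_coeff n m \<equiv> development velocity (lightlike (direction 0)) n (t m)"

lemma endpoint_coeff_Suc:
  assumes m: "m < M"
  shows "l ^ n *\<^sub>R endpoint_coeff n (Suc m) =
    (\<Sum>k\<le>n. ((l * edge_length m) ^ k / fact k) *\<^sub>R
      (boost (direction m) ^^ k) (l ^ (n - k) *\<^sub>R endpoint_coeff (n - k) m))"
proof -
  obtain B where B: "\<And>u. norm (velocity u) \<le> B"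
    using velocity_bounded by blast
  let ?h = "t (Suc m) - t m"
  have h: "?h > 0" using t_less [OF m] by simp
  have pw: "(boost (c *\<^sub>R v) ^^ k) y = c ^ k *\<^sub>R (boost v ^^ k) y" for c v k and y :: "real ^ 'd option"
    by (induction k) (simp_all add: boost.scaleR_left boost.scaleR_right)
  have sc: "(boost v ^^ k) (c *\<^sub>R y) = c *\<^sub>R (boost v ^^ k) y" for c v k and y :: "real ^ 'd option"
    by (induction k) (simp_all add: boost.scaleR_right)
  have "endpoint_coeff n (Suc m) = (\<Sum>k\<le>n. (?h ^ k / fact k) *\<^sub>R
      (boost ((edge_length m / ?h) *\<^sub>R direction m) ^^ k) (endpoint_coeff (n - k) m))"
    by (rule development_linear_piece [OF velocity_measurable B _ velocity_piece [OF m]])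
      (use t_mono [of 0 m] m h in \<open>auto simp: t_0\<close>)
  also have "\<dots> = (\<Sum>k\<le>n. (edge_length m ^ k / fact k) *\<^sub>R
      (boost (direction m) ^^ k) (endpoint_coeff (n - k) m))"
    using h by (simp add: pw power_divide)
  finally have "l ^ n *\<^sub>R endpoint_coeff n (Suc m) = (\<Sum>k\<le>n. l ^ n *\<^sub>R (edge_length m ^ k / fact k) *\<^sub>R
      (boost (direction m) ^^ k) (endpoint_coeff (n - k) m))"
    by (simp add: scaleR_sum_right)
  also have "l ^ n = l ^ k * l ^ (n - k)" if "k \<le> n" for k
    using that by (simp flip: power_add)
  then have "(\<Sum>k\<le>n. l ^ n *\<^sub>R (edge_length m ^ k / fact k) *\<^sub>R
      (boost (direction m) ^^ k) (endpoint_coeff (n - k) m))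
     = (\<Sum>k\<le>n. ((l * edge_length m) ^ k / fact k) *\<^sub>R
      (boost (direction m) ^^ k) (l ^ (n - k) *\<^sub>R endpoint_coeff (n - k) m))"
    by (intro sum.cong refl) (simp add: sc power_mult_distrib mult_ac)
  finally show ?thesis .
qed

text \<open>After division by the exponential of the traversed length, each edge acts in the limit as the
projection onto its lightlike direction.  The factor with index \<open>0\<close> of the product is
\<open>1\<close>, because \<open>i - 1 = 0\<close> for \<open>i = 0\<close> and \<open>direction 0\<close> is a unit vector; likewise the vector is the
initial one for \<open>m = 0\<close>.\<close>

lemma endpoint_series:
  assumes "m \<le> M"
  shows "summable (\<lambda>n. norm (l ^ n *\<^sub>R endpoint_coeff n m))"
    and "((\<lambda>l. exp (- l * (\<Sum>i<m. edge_length i)) *\<^sub>R (\<Sum>n. l ^ n *\<^sub>R endpoint_coeff n m)) \<longlongrightarrow>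
       (\<Prod>i<m. (1 + direction i \<bullet> direction (i - 1)) / 2) *\<^sub>R lightlike (direction (m - 1))) at_top"
  using assms
proof (induction m arbitrary: l)
  case 0
  obtain B where B: "\<And>u. norm (velocity u) \<le> B"
    using velocity_bounded by blast
  have z: "endpoint_coeff n 0 = (if n = 0 then lightlike (direction 0) else 0)" for n
    by (cases n) (simp_all add: t_0 development_0 development_Suc(2) [OF velocity_measurable B])
  have s: "(\<lambda>n. l ^ n *\<^sub>R endpoint_coeff n 0) sums lightlike (direction 0)" for l
    using sums_single [of 0 "\<lambda>_. lightlike (direction 0)"]
    by (rule sums_cong [THEN iffD1, rotated]) (simp add: z)
  case 1
  have "summable (\<lambda>n. if n = 0 then norm (lightlike (direction 0)) else 0)"
    by (rule sums_summable [OF sums_single])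
  then show ?case
    by (rule summable_cong [THEN iffD1, rotated]) (simp add: z)
  case 2
  show ?case using sums_unique [OF s] by simp
next
  case (Suc m)
  let ?v = "direction m" and ?len = "edge_length m" and ?L = "\<Sum>i<m. edge_length i"
  define Y where "Y l = (\<Sum>n. l ^ n *\<^sub>R endpoint_coeff n m)" for l
  define y where "y l = exp (- l * ?L) *\<^sub>R Y l" for l
  define c where "c = (\<Prod>i<m. (1 + direction i \<bullet> direction (i - 1)) / 2)"
  have lin: "light_proj w (r *\<^sub>R z) = r *\<^sub>R light_proj w z" for w r and z :: "real ^ 'd option"
    by (rule linear_scale [OF bounded_linear.linear [OF bounded_linear_light_proj]])
  have m: "m < M" if "Suc m \<le> M" using that by simp
  {
    case 1
    show ?case
      unfolding endpoint_coeff_Suc [OF m [OF 1]]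
      by (rule boost_exp_sums(1) [OF norm_direction Suc.IH(1)]) (use 1 in auto)
  next
    case 2
    have len: "?len > 0" using edge_length_pos [OF m [OF 2]] .
    have Y: "(\<Sum>n. l ^ n *\<^sub>R endpoint_coeff n (Suc m))
      = exp (l * ?len) *\<^sub>R light_proj ?v (Y l) + exp (- (l * ?len)) *\<^sub>R light_proj (- ?v) (Y l)
           + (Y l - light_proj ?v (Y l) - light_proj (- ?v) (Y l))" for l
      unfolding Y_def endpoint_coeff_Suc [OF m [OF 2]]
      by (rule boost_exp_sums(2) [OF norm_direction Suc.IH(1)]) (use 2 in auto)
    \<comment> \<open>relative to the growth of the eigenvalue \<open>1\<close>, the other two parts decay exponentially\<close>
    have eq: "exp (- l * (\<Sum>i<Suc m. edge_length i)) *\<^sub>R (\<Sum>n. l ^ n *\<^sub>R endpoint_coeff n (Suc m))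
      = light_proj ?v (y l) + exp (- l * ?len) ^ 2 *\<^sub>R light_proj (- ?v) (y l)
           + exp (- l * ?len) *\<^sub>R (y l - light_proj ?v (y l) - light_proj (- ?v) (y l))" for l
    proof -
      have e: "exp (- l * (\<Sum>i<Suc m. edge_length i)) = exp (- l * ?L) * exp (- l * ?len)"
        by (simp add: exp_add [symmetric] algebra_simps)
      have f: "exp (- l * ?len) * exp (l * ?len) = 1"
        by (simp add: exp_add [symmetric])
      show ?thesis
        unfolding Y e y_def lin using f
        by (simp add: scaleR_add_right scaleR_diff_right power2_eq_square mult_ac)
    qed
    have y_lim: "(y \<longlongrightarrow> c *\<^sub>R lightlike (direction (m - 1))) at_top"
      using Suc.IH(2) 2 unfolding y_def Y_def c_def by simp
    have e_lim: "((\<lambda>l. exp (- l * ?len)) \<longlongrightarrow> 0) at_top"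
    proof -
      have "filterlim (\<lambda>l::real. l * ?len) at_top at_top"
        using filterlim_tendsto_pos_mult_at_top [OF tendsto_const len filterlim_ident] by (simp add: mult.commute)
      then have "filterlim (\<lambda>l. - (l * ?len)) at_bot at_top"
        by (simp add: filterlim_uminus_at_bot)
      then show ?thesis
        using filterlim_compose [OF exp_at_bot] by simp
    qed
    note p_lim = bounded_linear.tendsto [OF bounded_linear_light_proj y_lim]
    have "((\<lambda>l. light_proj ?v (y l) + exp (- l * ?len) ^ 2 *\<^sub>R light_proj (- ?v) (y l)
           + exp (- l * ?len) *\<^sub>R (y l - light_proj ?v (y l) - light_proj (- ?v) (y l)))
       \<longlongrightarrow> light_proj ?v (c *\<^sub>R lightlike (direction (m - 1)))
          + 0 ^ 2 *\<^sub>R light_proj (- ?v) (c *\<^sub>R lightlike (direction (m - 1)))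
          + 0 *\<^sub>R (c *\<^sub>R lightlike (direction (m - 1)) - light_proj ?v (c *\<^sub>R lightlike (direction (m - 1)))
             - light_proj (- ?v) (c *\<^sub>R lightlike (direction (m - 1))))) at_top"
      by (intro tendsto_add tendsto_scaleR tendsto_diff tendsto_power p_lim e_lim y_lim)
    then show ?case
      unfolding eq by (simp add: lin light_proj_lightlike c_def)
  }
qed

text \<open>The boost representation is admissible in the supremum \<^const>\<open>norm_to_hom\<close>, and \<open>sqrt 2\<close> is the norm
of the initial vector.\<close>

lemma norm_endpoint_coeff_le:
  "norm (endpoint_coeff n M)
     \<le> sqrt 2 * norm_to_hom n (normalised_signature \<gamma> n) * ((\<Sum>i<M. edge_length i) ^ n / fact n)"
proof -
  obtain B where B: "\<And>u. norm (velocity u) \<le> B"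
    using velocity_bounded by blast
  let ?L = "curve_length \<gamma>" and ?len = "\<Sum>i<M. edge_length i"
  let ?N = "norm_to_hom n (normalised_signature \<gamma> n)"
  define T where "T = (\<lambda>w. LINT u : open_simplex n | Pi\<^sub>M {..<n} (\<lambda>_. lborel).
        (\<Prod>k<n. vector_derivative \<gamma> (at (u k)) $ (w ! k)))"
  have sig: "normalised_signature \<gamma> n = (\<lambda>w. (fact n / ?L ^ n) * T w)"
    by (rule ext) (simp add: normalised_signature_def T_def)
  have "tensor_hom n (\<lambda>_. boost_hom) (normalised_signature \<gamma> n)
      = (fact n / ?L ^ n) *\<^sub>R tensor_hom n (\<lambda>_. boost_hom) T"
    unfolding sig tensor_hom_def by (simp add: scaleR_sum_right)
  then have "norm (tensor_hom n (\<lambda>_. boost_hom) T)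
      = norm (tensor_hom n (\<lambda>_. boost_hom) (normalised_signature \<gamma> n)) * (?L ^ n / fact n)"
    using curve_length_pos by simp
  moreover have le_N: "norm (tensor_hom n (\<lambda>_. boost_hom) (normalised_signature \<gamma> n)) \<le> ?N"
    unfolding norm_to_hom_def
    by (rule cSUP_upper [OF _ norm_to_hom_bdd]) (simp add: norm_boost_hom)
  ultimately have T: "norm (tensor_hom n (\<lambda>_. boost_hom) T) \<le> ?N * (?L ^ n / fact n)"
    using curve_length_pos by (simp add: divide_right_mono mult_right_mono)
  have N: "0 \<le> ?N"
    by (rule order_trans [OF norm_ge_zero le_N])
  have "norm (endpoint_coeff n M) \<le> norm (tensor_hom n (\<lambda>_. boost_hom) T) * norm (lightlike (direction 0))"
    unfolding t_M T_def
    by (rule norm_development_le_tensor_hom [OF velocity_measurable B]) (simp add: velocity_def)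
  also have "norm (lightlike (direction 0)) = sqrt 2"
    using norm_direction [OF M_pos] by (simp add: norm_eq_sqrt_inner inner_lightlike)
  also have "norm (tensor_hom n (\<lambda>_. boost_hom) T) \<le> ?N * (?len ^ n / fact n)"
    using T curve_length_pos curve_length_le N
    by (elim order_trans) (intro mult_left_mono divide_right_mono power_mono, auto)
  finally show ?thesis
    by (simp add: mult_ac)
qed

text \<open>Otherwise the limit in \<open>endpoint_series\<close>, of norm at least \<open>sqrt 2 * k\<close>, would have norm at most
\<open>sqrt 2 * (c * k)\<close>.\<close>

lemma infinite_norm_to_hom_ge:
  assumes c: "0 \<le> c" "c < 1"
    and k: "0 < k" "k \<le> (\<Prod>i<M. (1 + direction i \<bullet> direction (i - 1)) / 2)"
  shows "infinite {n. norm_to_hom n (normalised_signature \<gamma> n) \<ge> c * k}"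
proof
  let ?N = "\<lambda>n. norm_to_hom n (normalised_signature \<gamma> n)" and ?len = "\<Sum>i<M. edge_length i"
  let ?p = "\<Prod>i<M. (1 + direction i \<bullet> direction (i - 1)) / 2"
  assume "finite {n. ?N n \<ge> c * k}"
  then obtain n0 where "\<And>n. ?N n \<ge> c * k \<Longrightarrow> n < n0"
    unfolding finite_nat_set_iff_bounded by blast
  then have N: "?N n \<le> c * k" if "n \<ge> n0" for n
    using that by (meson leI less_le_not_le linorder_le_cases)
  have len: "?len > 0"
    using M_pos edge_length_pos by (intro sum_pos) auto
  have "norm (?p *\<^sub>R lightlike (direction (M - 1))) \<le> sqrt 2 * (c * k)"
  proof (rule norm_limit_le_of_coefficient_bound [OF endpoint_series(2) endpoint_series(1) len])
    show "norm (endpoint_coeff n M) \<le> sqrt 2 * (c * k) * (?len ^ n / fact n)" if "n \<ge> n0" for n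
      using N [OF that] len
      by (intro order_trans [OF norm_endpoint_coeff_le] mult_right_mono mult_left_mono) auto
  qed (use c k in auto)
  moreover have "norm (lightlike (direction (M - 1))) = sqrt 2"
    using norm_direction [of "M - 1"] M_pos by (simp add: norm_eq_sqrt_inner inner_lightlike)
  ultimately have "?p \<le> c * k" using k by simp
  also have "c * k < k" using c k by simp
  finally show False using k by simp
qed

lemma cos_vertex_angle:
  assumes "0 < i" "i < M"
  shows "cos (vertex_angle (x (i - 1)) (x i) (x (i + 1))) = - (direction i \<bullet> direction (i - 1))"
proof -
  define a b where "a = x i - x (i - 1)" and "b = x (i + 1) - x i"
  have i: "Suc (i - 1) = i" "i - 1 < M" using assms by auto
  have ab: "x (i - 1) - x i = - a" "x (i + 1) - x i = b"
    "direction (i - 1) = a /\<^sub>R norm a" "direction i = b /\<^sub>R norm b"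
    using i by (simp_all add: a_def b_def direction_def edge_length_def)
  have "((x (i - 1) - x i) \<bullet> (x (i + 1) - x i)) / (norm (x (i - 1) - x i) * norm (x (i + 1) - x i))
      = - (direction i \<bullet> direction (i - 1))"
    unfolding ab by (simp add: inner_commute divide_inverse)
  moreover have "\<bar>direction i \<bullet> direction (i - 1)\<bar> \<le> 1"
    using Cauchy_Schwarz_ineq2 [of "direction i" "direction (i - 1)"] norm_direction assms i by simp
  ultimately show ?thesis
    by (simp add: vertex_angle_def cos_arccos_abs)
qed

end

section \<open>The lower bound\<close>

theorem theorem4p1:
  fixes \<gamma> :: "real \<Rightarrow> real ^ 'd" and M :: nat and x :: "nat \<Rightarrow> real ^ 'd" and \<Omega> c :: real
  assumes "M > 0"
    and "nondegenerate_piecewise_linear \<gamma> M x"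
    and "2 * \<Omega> > 0"
    and "M \<ge> 2 \<Longrightarrow> 2 * \<Omega> = Min ((\<lambda>i. vertex_angle (x (i - 1)) (x i) (x (i + 1))) ` {0<..<M})"
    and "0 < c" and "c < 1"
  shows "\<exists>n :: nat \<Rightarrow> nat. strict_mono_on {1..} n \<and>
    (\<forall>k\<ge>1. norm_to_hom (n k) (normalised_signature \<gamma> (n k))
              \<ge> c * exp (- (real M - 1) * K_const \<Omega>))"
proof -
  obtain t where "linear_pieces \<gamma> M x t"
    using assms(2) unfolding nondegenerate_piecewise_linear_def linear_pieces_def by blast
  then interpret linear_pieces \<gamma> M x t .
  let ?f = "\<lambda>i. (1 + direction i \<bullet> direction (i - 1)) / 2" and ?q = "(1 - cos \<Omega>) / 2"
  have angle: "2 * \<Omega> \<le> vertex_angle (x (i - 1)) (x i) (x (i + 1))"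
    "vertex_angle (x (i - 1)) (x i) (x (i + 1)) < pi" if "0 < i" "i < M" for i
  proof -
    show "vertex_angle (x (i - 1)) (x i) (x (i + 1)) < pi"
      using assms(2) that unfolding nondegenerate_piecewise_linear_def by simp
    have "Min ((\<lambda>i. vertex_angle (x (i - 1)) (x i) (x (i + 1))) ` {0<..<M})
        \<le> vertex_angle (x (i - 1)) (x i) (x (i + 1))"
      using that by (intro Min_le) auto
    then show "2 * \<Omega> \<le> vertex_angle (x (i - 1)) (x i) (x (i + 1))"
      using assms(4) that by linarith
  qed
  have factor: "?q \<le> ?f i" if "0 < i" "i < M" for i
  proof -
    have "cos (vertex_angle (x (i - 1)) (x i) (x (i + 1))) \<le> cos \<Omega>"
      using angle [OF that] assms(3) by (intro cos_monotone_0_pi_le) auto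
    then show ?thesis unfolding cos_vertex_angle [OF that] by simp
  qed
  have "exp (- (real M - 1) * K_const \<Omega>) = ?q ^ (M - 1)"
  proof (cases "M = 1")
    case False
    then have M: "0 < (1::nat)" "1 < M" using assms(1) by auto
    have "cos \<Omega> < cos 0"
      using angle [OF M] assms(3) by (intro cos_monotone_0_pi) auto
    then have q: "0 < ?q" by simp
    have "K_const \<Omega> = - ln ?q"
      using assms(3) q by (simp add: K_const_def flip: ln_inverse)
    then have "- (real M - 1) * K_const \<Omega> = real (M - 1) * ln ?q"
      using M by (simp add: algebra_simps)
    then show ?thesis using q by (simp add: exp_of_nat_mult)
  qed simp
  also have "\<dots> = (\<Prod>i\<in>{..<M} - {0}. ?q)"
    using assms(1) by simp
  also have "\<dots> \<le> (\<Prod>i\<in>{..<M} - {0}. ?f i)"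
    using factor by (intro prod_mono) auto
  also have "\<dots> = (\<Prod>i<M. ?f i)"
  proof -
    have "direction 0 \<bullet> direction 0 = 1"
      using norm_direction [OF assms(1)] by (simp add: norm_eq_1)
    then show ?thesis
      using assms(1) prod.remove [of "{..<M}" 0 ?f] by simp
  qed
  finally have "infinite {n. norm_to_hom n (normalised_signature \<gamma> n) \<ge> c * exp (- (real M - 1) * K_const \<Omega>)}"
    using assms(5,6) by (intro infinite_norm_to_hom_ge) auto
  then obtain r :: "nat \<Rightarrow> nat" where "strict_mono r"
    "\<And>k. r k \<in> {n. norm_to_hom n (normalised_signature \<gamma> n) \<ge> c * exp (- (real M - 1) * K_const \<Omega>)}"
    using infinite_enumerate by blast
  then show ?thesis
    by (intro exI [of _ r]) (auto simp: strict_mono_def strict_mono_on_def)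
qed

end
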